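(* The smallest order of a ring that is NI, not abelian and not reflexive is $8$, and, up to isomorphism, the unique NI nonabelian nonreflexive ring of order $8$ is $U_2(\mathbb{F}_2)$.
   Context: All rings are associative with unity. $U_2(\mathbb{F}_2)$ is the ring of upper triangular $2\times 2$ matrices over $\mathbb{F}_2$. A ring $R$ is NI if its set $N(R)$ of nilpotent elements is a two-sided ideal (equivalently, $N(R)$ equals the upper nil radical of $R$); abelian if each idempotent of $R$ is central; reflexive if for all $a,b\in R$, $aRb=0$ implies $bRa=0$. *)

theory Defs
  imports "Jordan_Normal_Form.Matrix" "HOL-Algebra.QuotRing" "HOL-Library.Z2"
begin

definition nilpotents :: "('a, 'm) ring_scheme \<Rightarrow> 'a set" where
  "nilpotents R = {x \<in> carrier R. \<exists>n::nat. n > 0 \<and> x [^]\<^bsub>R\<^esub> n = \<zero>\<^bsub>R\<^esub>}"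

definition NI_ring :: "('a, 'm) ring_scheme \<Rightarrow> bool" where
  "NI_ring R \<longleftrightarrow> ring R \<and> ideal (nilpotents R) R"

text \<open>``Abelian'' is meant in the sense of ring theory (idempotents are central); it does not mean
  commutative.\<close>

definition abelian_ring :: "('a, 'm) ring_scheme \<Rightarrow> bool" where
  "abelian_ring R \<longleftrightarrow> ring R \<and>
     (\<forall>e \<in> carrier R. e \<otimes>\<^bsub>R\<^esub> e = e \<longrightarrow>
        (\<forall>x \<in> carrier R. e \<otimes>\<^bsub>R\<^esub> x = x \<otimes>\<^bsub>R\<^esub> e))"

definition reflexive_ring :: "('a, 'm) ring_scheme \<Rightarrow> bool" where
  "reflexive_ring R \<longleftrightarrow> ring R \<and>
     (\<forall>a \<in> carrier R. \<forall>b \<in> carrier R.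
        (\<forall>r \<in> carrier R. a \<otimes>\<^bsub>R\<^esub> r \<otimes>\<^bsub>R\<^esub> b = \<zero>\<^bsub>R\<^esub>) \<longrightarrow>
        (\<forall>r \<in> carrier R. b \<otimes>\<^bsub>R\<^esub> r \<otimes>\<^bsub>R\<^esub> a = \<zero>\<^bsub>R\<^esub>))"

definition upper_triangular_ring :: "'a::semiring_1 itself \<Rightarrow> nat \<Rightarrow> 'a mat ring" where
  "upper_triangular_ring ty n =
     (ring_mat ty n ())\<lparr>carrier := {A \<in> carrier_mat n n. upper_triangular A}\<rparr>"

text \<open>The type \<^typ>\<open>bit\<close> is the field with two elements.\<close>

abbreviation U2_F2 :: "bit mat ring" where
  "U2_F2 \<equiv> upper_triangular_ring TYPE(bit) 2"

end

theory Submission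
  imports Defs
begin

text \<open>
  If \<open>e\<close> is a noncentral idempotent and \<open>f = 1 - e\<close>, then \<open>eRf\<close> or \<open>fRe\<close> is nonzero; after swapping
  \<open>e\<close> and \<open>f\<close> take \<open>n \<noteq> 0\<close> in \<open>eRf\<close>. The Peirce components of \<open>a e + b n + c f\<close>, where
  \<open>a\<close>, \<open>b\<close>, \<open>c\<close> range over \<open>{0, 1}\<close>, recover the coefficients, so these elements are eight distinct
  ones. If \<open>R\<close> has order \<open>8\<close> there are no others; comparing Peirce components then forces
  \<open>e + e = n + n = f + f = 0\<close>, and \<open>e\<close>, \<open>n\<close>, \<open>f\<close> multiply like the matrix units of \<open>U\<^sub>2(F\<^sub>2)\<close>.
\<close>

section \<open>Coordinates on upper triangular 2 by 2 matrices\<close>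

definition tri :: "'a \<Rightarrow> 'a \<Rightarrow> 'a \<Rightarrow> 'a::zero mat" where
  "tri a b c = mat 2 2 (\<lambda>(i, j). if i = 0 then (if j = 0 then a else b) else if j = 0 then 0 else c)"

lemma tri_index [simp]:
  "tri a b c $$ (0, 0) = a" "tri a b c $$ (0, 1) = b" "tri a b c $$ (1, 0) = 0" "tri a b c $$ (1, 1) = c"
  "dim_row (tri a b c) = 2" "dim_col (tri a b c) = 2"
  by (simp_all add: tri_def)

lemma tri_inject [simp]: "tri a b c = tri a' b' c' \<longleftrightarrow> a = a' \<and> b = b' \<and> c = c'"
  by (metis tri_index(1,2,4))

lemma tri_add [simp]:
  "tri a b c + tri a' b' c' = tri (a + a') (b + b') (c + c' :: 'a::monoid_add)"
  by (rule eq_matI) (auto simp: tri_def)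

lemma tri_mult [simp]:
  "tri a b c * tri a' b' c' = tri (a * a') (a * b' + b * c') (c * c' :: 'a::semiring_1)"
  by (rule eq_matI) (auto simp: tri_def scalar_prod_def numeral_2_eq_2)

lemma upper_triangular_ring_2_simps:
  "carrier (upper_triangular_ring TYPE('a::semiring_1) 2) = {tri a b c | a b c. True}"
  "mult (upper_triangular_ring TYPE('a) 2) = (*)"
  "add (upper_triangular_ring TYPE('a) 2) = (+)"
  "one (upper_triangular_ring TYPE('a) 2) = tri 1 0 1"
  "zero (upper_triangular_ring TYPE('a) 2) = tri 0 0 0"
proof -
  have "\<exists>a b c. A = tri a b c" if A: "A \<in> carrier_mat 2 2" "upper_triangular A" for A :: "'a mat"
  proof -
    have "A = tri (A $$ (0, 0)) (A $$ (0, 1)) (A $$ (1, 1))"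
      using A by (intro eq_matI) (auto simp: tri_def less_2_cases_iff upper_triangularD)
    then show ?thesis by blast
  qed
  moreover have "tri a b c \<in> carrier_mat 2 2 \<and> upper_triangular (tri a b c)" for a b c :: 'a
    by (auto simp: tri_def less_2_cases_iff)
  ultimately show "carrier (upper_triangular_ring TYPE('a) 2) = {tri a b c | a b c. True}"
    by (auto simp: upper_triangular_ring_def)
  have "1\<^sub>m 2 = (tri 1 0 1 :: 'a mat)" "0\<^sub>m 2 2 = (tri 0 0 0 :: 'a mat)"
    by (auto intro!: eq_matI simp: tri_def)
  then show "one (upper_triangular_ring TYPE('a) 2) = tri 1 0 1"
    "zero (upper_triangular_ring TYPE('a) 2) = tri 0 0 0"
    by (simp_all add: upper_triangular_ring_def ring_mat_simps)
qed (simp_all add: upper_triangular_ring_def ring_mat_simps)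

section \<open>Ring-theoretic properties of upper triangular 2 by 2 matrices\<close>

lemma ring_upper_triangular_ring_2: "ring (upper_triangular_ring TYPE('a::ring_1) 2)"
proof (rule ringI)
  show "abelian_group (upper_triangular_ring TYPE('a) 2)"
  proof (rule abelian_groupI)
    fix x assume "x \<in> carrier (upper_triangular_ring TYPE('a) 2)"
    then obtain a b c where "x = tri a b c"
      by (auto simp: upper_triangular_ring_2_simps)
    then show "\<exists>y\<in>carrier (upper_triangular_ring TYPE('a) 2).
        y \<oplus>\<^bsub>upper_triangular_ring TYPE('a) 2\<^esub> x = \<zero>\<^bsub>upper_triangular_ring TYPE('a) 2\<^esub>"
      by (intro bexI[of _ "tri (-a) (-b) (-c)"]) (auto simp: upper_triangular_ring_2_simps)
  qed (auto simp: upper_triangular_ring_2_simps add_ac)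
  show "monoid (upper_triangular_ring TYPE('a) 2)"
    by (rule monoidI) (auto simp: upper_triangular_ring_2_simps algebra_simps)
qed (auto simp: upper_triangular_ring_2_simps algebra_simps)

text \<open>Powers act entrywise on the diagonal, so without zero divisors a nilpotent matrix has
  zero diagonal; conversely a strictly upper triangular matrix squares to zero.\<close>

lemma nilpotents_upper_triangular_ring_2:
  "nilpotents (upper_triangular_ring TYPE('a::semiring_1_no_zero_divisors) 2) = {tri 0 b 0 | b. True}"
proof -
  let ?U = "upper_triangular_ring TYPE('a) 2"
  \<comment> \<open>The corner entry of a power stays existential, since only the diagonal
    matters.\<close>
  have diag: "\<exists>b'. tri a b c [^]\<^bsub>?U\<^esub> k = tri (a ^ k) b' (c ^ k)" for a b c :: 'a and k :: nat
  proof (induction k)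
    case (Suc k)
    then obtain b' where "tri a b c [^]\<^bsub>?U\<^esub> k = tri (a ^ k) b' (c ^ k)" by blast
    then show ?case
      by (simp add: nat_pow_def upper_triangular_ring_2_simps power_commutes)
  qed (simp add: nat_pow_def upper_triangular_ring_2_simps)
  have "a = 0 \<and> c = 0" if "tri a b c [^]\<^bsub>?U\<^esub> k = tri 0 0 0" for a b c :: 'a and k :: nat
    using diag[of a b c k] that by auto
  moreover have "tri 0 b 0 [^]\<^bsub>?U\<^esub> Suc (Suc 0) = tri 0 0 0" for b :: 'a
    by (simp add: nat_pow_def upper_triangular_ring_2_simps)
  ultimately show ?thesis
    unfolding nilpotents_def upper_triangular_ring_2_simps by (fastforce intro: exI[of _ "Suc (Suc 0)"])
qed

lemma NI_upper_triangular_ring_2: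
  "NI_ring (upper_triangular_ring TYPE('a::ring_1_no_zero_divisors) 2)"
proof -
  let ?U = "upper_triangular_ring TYPE('a) 2"
  interpret ring ?U by (rule ring_upper_triangular_ring_2)
  have "ideal {tri 0 b 0 | b :: 'a. True} ?U"
  proof (rule idealI)
    show "subgroup {tri 0 b 0 | b :: 'a. True} (add_monoid ?U)"
    proof (rule add.subgroupI)
      fix x assume "x \<in> {tri 0 b 0 | b :: 'a. True}"
      then obtain b where x: "x = tri 0 b 0" by blast
      have "\<ominus>\<^bsub>?U\<^esub> x = tri 0 (-b) 0"
        by (rule minus_equality) (auto simp: x upper_triangular_ring_2_simps)
      then show "\<ominus>\<^bsub>?U\<^esub> x \<in> {tri 0 b 0 | b :: 'a. True}" by auto
    qed (auto simp: upper_triangular_ring_2_simps)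
  qed (auto simp: upper_triangular_ring_2_simps ring_axioms)
  then show ?thesis
    by (simp add: NI_ring_def ring_axioms nilpotents_upper_triangular_ring_2)
qed

lemma not_abelian_upper_triangular_ring_2:
  "\<not> abelian_ring (upper_triangular_ring TYPE('a::semiring_1) 2)"
proof
  let ?U = "upper_triangular_ring TYPE('a) 2"
  assume "abelian_ring ?U"
  \<comment> \<open>The matrix units E11 and E12 do not commute: E11 E12 = E12, but E12 E11 =
    0.\<close>
  moreover have "tri 1 0 0 \<in> carrier ?U" "tri 0 1 0 \<in> carrier ?U"
    "tri 1 0 0 \<otimes>\<^bsub>?U\<^esub> tri 1 0 0 = tri 1 0 0"
    by (auto simp: upper_triangular_ring_2_simps)
  ultimately have "tri 1 0 0 \<otimes>\<^bsub>?U\<^esub> tri 0 1 0 = tri 0 1 0 \<otimes>\<^bsub>?U\<^esub> tri 1 0 0"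
    unfolding abelian_ring_def by blast
  then show False
    by (simp add: upper_triangular_ring_2_simps)
qed

lemma not_reflexive_upper_triangular_ring_2:
  "\<not> reflexive_ring (upper_triangular_ring TYPE('a::semiring_1) 2)"
proof
  let ?U = "upper_triangular_ring TYPE('a) 2"
  assume "reflexive_ring ?U"
  \<comment> \<open>The product E22 r E11 isolates the lower left entry of \<open>r\<close>, which
    is zero; in the opposite order E11 E12 E22 = E12 survives.\<close>
  moreover have "\<forall>r\<in>carrier ?U. tri 0 0 1 \<otimes>\<^bsub>?U\<^esub> r \<otimes>\<^bsub>?U\<^esub> tri 1 0 0 = \<zero>\<^bsub>?U\<^esub>"
    by (auto simp: upper_triangular_ring_2_simps)
  ultimately have "\<forall>r\<in>carrier ?U. tri 1 0 0 \<otimes>\<^bsub>?U\<^esub> r \<otimes>\<^bsub>?U\<^esub> tri 0 0 1 = \<zero>\<^bsub>?U\<^esub>"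
    unfolding reflexive_ring_def upper_triangular_ring_2_simps by blast
  moreover have "tri 0 1 0 \<in> carrier ?U"
    by (auto simp: upper_triangular_ring_2_simps)
  ultimately have "tri 1 0 0 \<otimes>\<^bsub>?U\<^esub> tri 0 1 0 \<otimes>\<^bsub>?U\<^esub> tri 0 0 1 = \<zero>\<^bsub>?U\<^esub>"
    by blast
  then show False
    by (simp add: upper_triangular_ring_2_simps)
qed

section \<open>Counting triples of bits and the matrices over them\<close>

lemma card_UNIV_bit: "card (UNIV :: bit set) = 2" "finite (UNIV :: bit set)"
proof -
  have U: "UNIV = {0, 1 :: bit}" using bit_not_zero_iff by blast
  show "card (UNIV :: bit set) = 2" by (subst U) simp
  show "finite (UNIV :: bit set)" by (subst U) simp
qed

lemma card_UNIV_bit3: "card (UNIV :: (bit \<times> bit \<times> bit) set) = 8"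
  by (simp add: card_UNIV_bit flip: UNIV_Times_UNIV)

lemma order_U2_F2: "order U2_F2 = 8"
proof -
  have "carrier U2_F2 = (\<lambda>(a, b, c). tri a b c) ` UNIV"
    by (auto simp: upper_triangular_ring_2_simps image_iff)
  moreover have "inj (\<lambda>(a, b, c). tri a b c :: bit mat)"
    by (auto intro: injI)
  ultimately show ?thesis
    by (simp add: order_def card_image card_UNIV_bit3)
qed

section \<open>Rings with a nonzero element \<open>n\<close> in the Peirce corner
  \<open>eRf\<close>\<close>

locale peirce_corner = ring +
  fixes e n f
  assumes carr [simp]: "e \<in> carrier R" "n \<in> carrier R" "f \<in> carrier R"
    and mult_simps [simp]: "e \<otimes> e = e" "f \<otimes> f = f" "e \<otimes> f = \<zero>" "f \<otimes> e = \<zero>" "e \<otimes> n = n" "n \<otimes> f = n"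
    and e_plus_f: "e \<oplus> f = \<one>"
    and n_nonzero: "n \<noteq> \<zero>"
begin

text \<open>Writing \<open>n\<close> as \<open>n \<otimes> f\<close> or \<open>e \<otimes> n\<close>
  puts \<open>e\<close> and \<open>f\<close> side by side, where they annihilate each other; the
  square of \<open>n\<close> then reduces to \<open>n \<otimes> e = \<zero>\<close>.\<close>

lemma mult_zero [simp]: "n \<otimes> e = \<zero>" "f \<otimes> n = \<zero>" "n \<otimes> n = \<zero>"
proof -
  have "n \<otimes> e = n \<otimes> f \<otimes> e" by simp
  \<comment> \<open>The deleted rule would contract \<open>n \<otimes> f\<close> back to
    \<open>n\<close> before reassociation exposes \<open>f \<otimes> e\<close>.\<close>
  also have "\<dots> = \<zero>" by (simp add: m_assoc del: mult_simps(6))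
  finally show ne: "n \<otimes> e = \<zero>" .
  have "f \<otimes> n = f \<otimes> e \<otimes> n" by (simp add: m_assoc del: mult_simps(4))
  also have "\<dots> = \<zero>" by simp
  finally show "f \<otimes> n = \<zero>" .
  have "n \<otimes> n = n \<otimes> e \<otimes> n" by (simp add: m_assoc del: ne)
  also have "\<dots> = \<zero>" by (simp add: ne)
  finally show "n \<otimes> n = \<zero>" .
qed

lemma nonzero: "e \<noteq> \<zero>" "f \<noteq> \<zero>"
  using n_nonzero mult_simps(5,6) by (metis carr(2) l_null, metis carr(2) r_null)

text \<open>This is a selection between zero and \<open>x\<close>, not yet a module action: it is
  additive in the bit only once \<open>x \<oplus> x = \<zero>\<close> is known.\<close>

definition scale :: "bit \<Rightarrow> 'a \<Rightarrow> 'a" where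
  "scale a x = (if a = 0 then \<zero> else x)"

definition comb :: "bit \<times> bit \<times> bit \<Rightarrow> 'a" where
  "comb = (\<lambda>(a, b, c). scale a e \<oplus> scale b n \<oplus> scale c f)"

lemma scale_closed [simp]: "x \<in> carrier R \<Longrightarrow> scale a x \<in> carrier R"
  by (simp add: scale_def)

lemma scale_zero [simp]: "scale a \<zero> = \<zero>"
  by (simp add: scale_def)

lemma scale_mult [simp]:
  assumes "x \<in> carrier R" "y \<in> carrier R"
  shows "scale a x \<otimes> y = scale a (x \<otimes> y)" "y \<otimes> scale a x = scale a (y \<otimes> x)"
  using assms by (auto simp: scale_def)

lemma scale_scale [simp]: "scale a (scale b x) = scale (a * b) x"
  by (simp add: scale_def)

lemma scale_sum:
  "x \<in> carrier R \<Longrightarrow> y \<in> carrier R \<Longrightarrow> scale a (x \<oplus> y) = scale a x \<oplus> scale a y"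
  by (simp add: scale_def)

text \<open>The assumption on \<open>x\<close> settles the case where both bits are 1, because they
  add up to 0 in \<open>bit\<close>.\<close>

lemma scale_add:
  assumes "x \<in> carrier R" "x \<oplus> x = \<zero>"
  shows "scale (a + b) x = scale a x \<oplus> scale b x"
  using assms by (cases a; cases b) (auto simp: scale_def)

lemma comb_closed [simp]: "comb t \<in> carrier R"
  by (cases t) (simp add: comb_def)

lemma peirce_components:
  "e \<otimes> comb (a, b, c) \<otimes> e = scale a e"
  "e \<otimes> comb (a, b, c) \<otimes> f = scale b n"
  "f \<otimes> comb (a, b, c) \<otimes> f = scale c f"
  by (simp_all add: comb_def l_distr r_distr)

text \<open>Equal combinations have equal Peirce components, and each component determines its bit
  because \<open>e\<close>, \<open>n\<close> and \<open>f\<close> are nonzero.\<close>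

lemma inj_comb: "inj comb"
proof (rule injI)
  fix s t assume eq: "comb s = comb t"
  obtain a b c a' b' c' where st: "s = (a, b, c)" "t = (a', b', c')"
    by (metis prod_cases3)
  have "scale a e = scale a' e" "scale b n = scale b' n" "scale c f = scale c' f"
    using eq unfolding st by (metis peirce_components)+
  then show "s = t"
    using nonzero n_nonzero unfolding st scale_def by (auto split: if_splits)
qed

text \<open>Finiteness is assumed because \<open>order\<close> assigns 0 to an infinite
  carrier.\<close>

lemma order_ge_8:
  assumes "finite (carrier R)"
  shows "8 \<le> order R"
proof -
  have "card (range comb) \<le> card (carrier R)"
    using assms by (intro card_mono) auto
  then show ?thesis
    by (simp add: order_def card_image inj_comb card_UNIV_bit3)
qed

lemma add_self_zero:
  assumes "range comb = carrier R"
  shows "e \<oplus> e = \<zero>" "n \<oplus> n = \<zero>" "f \<oplus> f = \<zero>"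
proof -
  \<comment> \<open>A multiple \<open>scale a x\<close> is zero or \<open>x\<close>, and
    \<open>x \<oplus> x = x\<close> cancels to \<open>x = \<zero>\<close>, so the double vanishes
    either way. Sandwiching each double between idempotents brings it into this form.\<close>
  have zero: "x \<oplus> x = \<zero>" if "x \<in> carrier R" "x \<oplus> x = scale a x" for x a
    using that add.l_cancel_one[of x x] by (auto simp: scale_def split: if_splits)
  have ex: "\<exists>a b c. x = comb (a, b, c)" if "x \<in> carrier R" for x
    using that assms by (metis imageE prod_cases3)
  obtain a b c where "e \<oplus> e = comb (a, b, c)" using ex[of "e \<oplus> e"] by auto
  then have "e \<otimes> (e \<oplus> e) \<otimes> e = scale a e" by (simp only: peirce_components)
  then show "e \<oplus> e = \<zero>" by (intro zero[of e a]) (simp_all add: l_distr r_distr)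
  obtain a b c where "n \<oplus> n = comb (a, b, c)" using ex[of "n \<oplus> n"] by auto
  then have "e \<otimes> (n \<oplus> n) \<otimes> f = scale b n" by (simp only: peirce_components)
  then show "n \<oplus> n = \<zero>" by (intro zero[of n b]) (simp_all add: l_distr r_distr)
  obtain a b c where "f \<oplus> f = comb (a, b, c)" using ex[of "f \<oplus> f"] by auto
  then have "f \<otimes> (f \<oplus> f) \<otimes> f = scale c f" by (simp only: peirce_components)
  then show "f \<oplus> f = \<zero>" by (intro zero[of f c]) (simp_all add: l_distr r_distr)
qed

lemma iso_U2_F2:
  assumes "order R = 8"
  shows "R \<simeq> U2_F2"
proof -
  have fin: "finite (carrier R)"
    using assms by (metis card.infinite order_def zero_neq_numeral)
  \<comment> \<open>The eight distinct combinations exhaust a carrier of eight elements.\<close>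
  have range: "range comb = carrier R"
    using fin assms
    by (intro card_subset_eq) (auto simp: order_def card_image inj_comb card_UNIV_bit3)
  note self = add_self_zero[OF range]
  \<comment> \<open>The isomorphism is built out of the matrix ring, where coefficients can be read
    off as entries, and is inverted at the end.\<close>
  define h where "h = (\<lambda>A :: bit mat. comb (A $$ (0, 0), A $$ (0, 1), A $$ (1, 1)))"
  have h_tri [simp]: "h (tri a b c) = comb (a, b, c)" for a b c
    by (simp add: h_def del: One_nat_def)
  have "h \<in> ring_iso U2_F2 R"
  proof (rule ring_iso_memI)
    show "bij_betw h (carrier U2_F2) (carrier R)"
      unfolding bij_betw_def
    proof
      show "inj_on h (carrier U2_F2)"
        by (auto simp: inj_on_def upper_triangular_ring_2_simps dest!: injD[OF inj_comb])
      have "h ` carrier U2_F2 = range comb"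
        by (auto simp: upper_triangular_ring_2_simps image_iff) (metis h_tri)
      then show "h ` carrier U2_F2 = carrier R"
        by (simp add: range)
    qed
    show "h \<one>\<^bsub>U2_F2\<^esub> = \<one>"
      by (simp add: upper_triangular_ring_2_simps comb_def scale_def e_plus_f)
  next
    fix A B assume "A \<in> carrier U2_F2" "B \<in> carrier U2_F2"
    then obtain a b c a' b' c' where AB: "A = tri a b c" "B = tri a' b' c'"
      by (auto simp: upper_triangular_ring_2_simps)
    show "h (A \<oplus>\<^bsub>U2_F2\<^esub> B) = h A \<oplus> h B"
      \<comment> \<open>Sums of bits must not turn into exclusive or, or \<open>scale_add\<close>
        would no longer match.\<close>
      by (simp add: AB upper_triangular_ring_2_simps comb_def scale_add self a_ac del: add_bit_eq_xor)
    show "h (A \<otimes>\<^bsub>U2_F2\<^esub> B) = h A \<otimes> h B"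
      by (simp add: AB upper_triangular_ring_2_simps comb_def scale_sum scale_add self a_ac l_distr r_distr mult.commute
          del: add_bit_eq_xor mult_bit_eq_and)
  qed (auto simp: h_def)
  then have "U2_F2 \<simeq> R"
    by (auto simp: is_ring_iso_def)
  then show ?thesis
    by (rule ring_iso_sym[OF ring_upper_triangular_ring_2])
qed

end

section \<open>From a noncentral idempotent to a Peirce corner\<close>

lemma (in ring) peirce_corner_exists:
  assumes "\<not> abelian_ring R"
  obtains e n f where "peirce_corner R e n f"
proof -
  obtain e x where e: "e \<in> carrier R" "e \<otimes> e = e" and x: "x \<in> carrier R" "e \<otimes> x \<noteq> x \<otimes> e"
    using assms ring_axioms unfolding abelian_ring_def by blast
  define f where "f = \<one> \<ominus> e"
  have "f \<in> carrier R" "f \<oplus> e = \<one>"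
    using e by (simp_all add: f_def minus_eq a_assoc l_neg)
  then have f: "f \<in> carrier R" "e \<oplus> f = \<one>" "f \<oplus> e = \<one>"
    using e a_comm[of e f] by simp_all
  have ef: "e \<otimes> f = \<zero>" "f \<otimes> e = \<zero>"
    using e by (simp_all add: f_def minus_eq l_distr r_distr r_minus l_minus r_neg)
  have ff: "f \<otimes> f = f"
    using l_distr[of e f f] e(1) f ef by simp
  \<comment> \<open>Stated for an arbitrary complementary pair so that it serves for both orders of
    \<open>e\<close> and \<open>f\<close>.\<close>
  have corner: "peirce_corner R e' (e' \<otimes> x \<otimes> f') f'"
    if "e' \<in> carrier R" "f' \<in> carrier R" "e' \<otimes> e' = e'" "f' \<otimes> f' = f'"
      "e' \<otimes> f' = \<zero>" "f' \<otimes> e' = \<zero>" "e' \<oplus> f' = \<one>" "e' \<otimes> x \<otimes> f' \<noteq> \<zero>" for e' f'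
  proof
    show "e' \<otimes> (e' \<otimes> x \<otimes> f') = e' \<otimes> x \<otimes> f'"
      using that(1-3) x(1) by (simp flip: m_assoc)
    show "e' \<otimes> x \<otimes> f' \<otimes> f' = e' \<otimes> x \<otimes> f'"
      using that(1,2,4) x(1) by (simp add: m_assoc)
  qed (use that x in auto)
  \<comment> \<open>If both off-diagonal components of \<open>x\<close> vanished, then
    \<open>e \<otimes> x\<close> and \<open>x \<otimes> e\<close> would both equal
    \<open>e \<otimes> x \<otimes> e\<close>, contrary to the choice of \<open>x\<close>.\<close>
  have "e \<otimes> x \<otimes> f \<noteq> \<zero> \<or> f \<otimes> x \<otimes> e \<noteq> \<zero>"
  proof (rule ccontr)
    assume "\<not> ?thesis"
    then have 0: "e \<otimes> x \<otimes> f = \<zero>" "f \<otimes> x \<otimes> e = \<zero>" by auto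
    have "e \<otimes> x = e \<otimes> x \<otimes> (e \<oplus> f)"
      using e x f by simp
    also have "\<dots> = e \<otimes> x \<otimes> e"
      using e x f(1) 0 by (simp add: r_distr)
    also have "\<dots> = (e \<oplus> f) \<otimes> (x \<otimes> e)"
      using e x f(1) 0 by (simp add: l_distr m_assoc)
    also have "\<dots> = x \<otimes> e"
      using e x f by simp
    finally show False using x by simp
  qed
  then show thesis
  proof
    assume "e \<otimes> x \<otimes> f \<noteq> \<zero>"
    then show thesis
      by (intro that[OF corner[of e f]]) (use e f ef ff in auto)
  next
    assume "f \<otimes> x \<otimes> e \<noteq> \<zero>"
    then show thesis
      by (intro that[OF corner[of f e]]) (use e f ef ff in auto)
  qed
qed

theorem theorem3p6:
  shows "(NI_ring U2_F2 \<and> \<not> abelian_ring U2_F2 \<and> \<not> reflexive_ring U2_F2 \<and> order U2_F2 = 8)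
    \<and> (\<forall>R :: ('a, 'm) ring_scheme.
          ring R \<and> finite (carrier R) \<and> NI_ring R \<and> \<not> abelian_ring R \<and> \<not> reflexive_ring R
          \<longrightarrow> 8 \<le> order R)
    \<and> (\<forall>R :: ('a, 'm) ring_scheme.
          ring R \<and> NI_ring R \<and> \<not> abelian_ring R \<and> \<not> reflexive_ring R \<and> order R = 8
          \<longrightarrow> R \<simeq> U2_F2)"
  \<comment> \<open>The bound and the uniqueness both apply to the corner that a noncentral
    idempotent of \<open>R\<close> provides.\<close>
  by (meson NI_upper_triangular_ring_2 not_abelian_upper_triangular_ring_2
      not_reflexive_upper_triangular_ring_2 order_U2_F2 ring.peirce_corner_exists
      peirce_corner.order_ge_8 peirce_corner.iso_U2_F2)

end
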